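(* (Debugger completeness.) Let $K_{start}$ be the start program state, let $\hookrightarrow_i$ be the transition relation of the underlying language (WebAssembly with input and output primitives), let $\rightarrow$ be the global transition relation of the remote multiverse debugger on pairs $C\mid S$ of client and server states, and let $$dbg_{start}=\langle \varnothing,\varnothing,\mathit{Node}\,\varnothing,\mathit{Node}\,\varnothing\rangle \;\mid\; \langle \textsc{Paused},\varnothing,\varnothing,\varnothing,0,K_{start}\rangle .$$ Then for every program state $K'$ with $K_{start}\hookrightarrow_i^* K'$ there exists a debugger state $dbg'$ such that $dbg_{start}\rightarrow^* dbg'$ and $K'$ is the program state contained in $dbg'$.
   Context: **Underlying language.** A program state is $K=\{\rho,\delta,st,\mu,e^*\}$ (locals, globals, value stack, memory, remaining instruction list). There are two primitive tables: $P^{In}$ (input primitives, each taking a tuple of argument values and returning one value) and $P^{Out}$ (output primitives, returning no value). $P^*$ denotes both tables together. "prim $K$" means the next instruction of $K$ is $\mathbf{call}\;j$ with $P^*(j)=p$ defined; "non-prim $K$" is its negation. The relation $\hookrightarrow_i$ consists of: - the standard deterministic WebAssembly small-step reduction, which applies to non-prim states (its details are irrelevant here; it may be taken as a given deterministic relation); - (Input-Prim) if $P^{In}(j)=p$ and $v\in\lfloor p(v_a^* )\rfloor$, then $\{\rho,\delta,v_a^*:v^*,\mu,(\mathbf{call}\;j):e^*\}\hookrightarrow_i\{\rho,\delta,v:v^*,\mu,e^*\}$; - (Output-Prim) if $P^{Out}(j)=p$, then (after executing $p(v_a^* )$ externally) $\{\rho,\delta,v_a^*:v^*,\mu,(\mathbf{call}\;j):e^*\}\hookrightarrow_i\{\rho,\delta,v^*,\mu,e^*\}$.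 Here $v_a^*$ are the arguments of $p$ (as many as its arity) on top of the stack, and $\lfloor p(v_a^* )\rfloor$ is the set of values the input primitive can nondeterministically return. $\mathrm{codom}(p)$ is the set of values the input primitive can produce; it is assumed that $\mathrm{codom}(p)=\lfloor p(v_a^* )\rfloor$ for all arguments. $K_{start}$ is the state in which the program has just been loaded. **Server.** A server state is $S=\langle es,m^i,m^o,bps,c,K\rangle$: execution state $es\in\{\textsc{Running},\textsc{Paused}\}$, inbox $m^i$, outbox $m^o$ (each empty or one message), set of breakpoints $bps$ (instruction identifiers), instruction counter $c\in\mathbb N$, and program state $K$. Server messages (from the client): $step$, $pause$, $play$, $break^+\,id$, $break^-\,id$, $mock\,v$, $inspect$, $reset$. Client messages (from the server): $prim(c,v)$, $executed(c)$, $snapshot(K)$; in addition the user may issue $slide(T_{target})$ to the client. $id(e)$ is the unique identifier of an instruction; below $e$ is the next instruction of $K$. The server relation $\hookrightarrow_{d,i}$ has the rules: - Run: if non-prim $K$, $id(e)\notin bps$, $K\hookrightarrow_i K'$: $\langle\textsc{Running},\varnothing,\varnothing,bps,c,K\rangle\hookrightarrow_{d,i}\langle\textsc{Running},\varnothing,\varnothing,bps,c+1,K'\rangle$. - Run-Prim-Out: if $e=\mathbf{call}\;j$, $P^{Out}(j)=p$, $id(e)\notin bps$: the same with $K'$ the result of Output-Prim. - Run-Prim-In: if $e=\mathbf{call}\;j$, $P^{In}(j)=p$, $v\in\lfloor p(v_a^* )\rfloor$, $id(e)\notin bps$: $\langle\textsc{Running},\varnothing,\varnothing,bps,c,K\rangle\hookrightarrow_{d,i}\langle\textsc{Running},\varnothing,prim(c+1,v),bps,0,K'\rangle$,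 where $K'$ is $K$ with the call removed and its arguments replaced by $v$. - Dbg-Break: if $id(e)\in bps$: $\langle\textsc{Running},\varnothing,\varnothing,bps,c,K\rangle\hookrightarrow_{d,i}\langle\textsc{Paused},\varnothing,executed(c),bps,0,K\rangle$. - Dbg-Pause: $\langle\textsc{Running},pause,\varnothing,bps,c,K\rangle\hookrightarrow_{d,i}\langle\textsc{Paused},\varnothing,executed(c),bps,0,K\rangle$. - Dbg-Step: if non-prim $K$ and $K\hookrightarrow_i K'$: $\langle\textsc{Paused},step,\varnothing,bps,0,K\rangle\hookrightarrow_{d,i}\langle\textsc{Paused},\varnothing,executed(1),bps,0,K'\rangle$. - Dbg-Step-Prim-Out: if $e=\mathbf{call}\;j$, $P^{Out}(j)=p$: the same with $K'$ the result of Output-Prim. - Dbg-Step-Prim-In: if $e=\mathbf{call}\;j$, $P^{In}(j)=p$, $v\in\lfloor p(v_a^* )\rfloor$: $\langle\textsc{Paused},step,\varnothing,bps,0,K\rangle\hookrightarrow_{d,i}\langle\textsc{Paused},\varnothing,prim(1,v),bps,0,K'\rangle$, with $K'$ as in Run-Prim-In. - Dbg-Mock: if $e=\mathbf{call}\;j$, $P^{In}(j)=p$, $v\in\mathrm{codom}(p)$: $\langle\textsc{Paused},mock\,v,\varnothing,bps,0,K\rangle\hookrightarrow_{d,i}\langle\textsc{Paused},\varnothing,prim(1,v),bps,0,K'\rangle$, with $K'$ as in Run-Prim-In. - Dbg-Bp-Add / Dbg-Bp-Rem: $\langle es,break^{\pm}\,id,\varnothing,bps,c,K\rangle\hookrightarrow_{d,i}\langle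 es,\varnothing,\varnothing,bps',c,K\rangle$ with $bps'=bps\cup\{id\}$, resp. $bps\setminus\{id\}$. - Dbg-Play: $\langle\textsc{Paused},play,\varnothing,bps,c,K\rangle\hookrightarrow_{d,i}\langle\textsc{Running},\varnothing,\varnothing,bps,c,K\rangle$. - Dbg-Inspect: $\langle\textsc{Paused},inspect,\varnothing,bps,c,K\rangle\hookrightarrow_{d,i}\langle\textsc{Paused},\varnothing,snapshot(K),bps,c,K\rangle$. - Dbg-Reset: $\langle\textsc{Paused},reset,\varnothing,bps,c,K\rangle\hookrightarrow_{d,i}\langle\textsc{Paused},\varnothing,\varnothing,bps,0,K_{start}\rangle$. **Client.** A multiverse tree is $T::=\mathit{Node}\,(tl,T)^*$ with edge labels $tl::=step\mid mock\,v$. A client state is $C=\langle m^i,m^o,T,T_{curr}\rangle$: inbox, outbox (a queue of server messages), tree root $T$, and current node $T_{curr}$ of $T$. The traverse operation along a list of labels walks from the current node, following for each label the child edge with that label if it exists and otherwise attaching a new leaf via such an edge. The client relation $\leadsto$ has the rules (the outbox $q$ is unchanged where shown): - Executed: $\langle executed(c),q,T,T_{curr}\rangle\leadsto\langle\varnothing,q,T',T'_{curr}\rangle$, the result of traversing $step^{c}$. - Prim: $\langle prim(c,v),q,T,T_{curr}\rangle\leadsto\langle\varnothing,q,T',T'_{curr}\rangle$, the result of traversing $step^{c-1}:mock\,v$. - Slide: if $T_{target}$ is $T_{curr}$ or a descendant of it, $\langle slide(T_{target}),\varnothing,T,T_{curr}\rangle\leadsto\langle\varnothing,msg^*,T,T_{curr}\rangle$,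 where $msg^*$ is the list of edge labels on the path from $T_{curr}$ to $T_{target}$. - Slide-Restart: otherwise, $\langle slide(T_{target}),\varnothing,T,T_{curr}\rangle\leadsto\langle\varnothing,reset:msg^*,T,T\rangle$, where $msg^*$ is the list of edge labels on the path from the root $T$ to $T_{target}$. - Concolic-Receive: $\langle snapshot(K),q,T,T_{curr}\rangle\leadsto\langle\varnothing,q,T',T_{conc}\rangle$, where $T_{conc}$ is the multiverse tree of suggested future paths computed from $K$ by a (bounded) concolic execution, and $T'$ is $T$ with the node $T_{curr}$ replaced by $T_{conc}$. The concolic analysis may be treated as a given function from program states to multiverse trees. **Global relation** $\rightarrow$ on $C\mid S$: - Server-To-Client: if $\langle m,q,T,T_{curr}\rangle\leadsto C'$, then $\langle\varnothing,q,T,T_{curr}\rangle\mid\langle es,\varnothing,m,bps,c,K\rangle\rightarrow C'\mid\langle es,\varnothing,\varnothing,bps,c,K\rangle$. - Client-To-Server: if $S=\langle es,\varnothing,\varnothing,bps,c,K\rangle$, $es\approx m$, and $\langle es,m,\varnothing,bps,c,K\rangle\hookrightarrow_{d,i}S'$, then $\langle\varnothing,m.q,T,T_{curr}\rangle\mid S\rightarrow\langle\varnothing,q,T,T_{curr}\rangle\mid S'$. Here $\textsc{Running}\approx m$ iff $m=pause$, and $\textsc{Paused}\approx m$ iff $m\neq pause$. - Server-Step: if all inboxes and outboxes of $C$ and $S$ are empty and $S\hookrightarrow_{d,i}S'$, then $C\mid S\rightarrow C\mid S'$. - User interaction: the user may at any time append any server message to the client's outbox, and, when all message queues are empty, may issue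 $slide(T_{target})$ for a node $T_{target}$ of $T$, which the client processes by $\leadsto$; these also count as steps of $\rightarrow$ and leave $S$ unchanged. The program state contained in a debugger state $C\mid S$ is the component $K$ of $S$. $R^*$ denotes the reflexive-transitive closure of $R$. *)

theory Defs
  imports Main
begin

text \<open>
  Every instruction occurrence carries its identifier. Apart from \<^emph>\<open>call\<close>, the instruction
  set is left abstract (type \<open>'o\<close>), and so are the representations of locals, globals and memory.
\<close>

datatype ('o, 'id) instr =
    Call (instr_id: 'id) nat
  | Other (instr_id: 'id) 'o

record ('l, 'g, 'v, 'm, 'o, 'id) prog_state =
  locals :: 'l
  globals :: 'g
  stack :: "'v list"  \<comment> \<open>top of the stack first\<close>
  memory :: 'm
  instrs :: "('o, 'id) instr list"

text \<open>\<open>outcomes p va\<close> is the set of values that \<open>p\<close> may return on the arguments \<open>va\<close>.\<close>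

record 'v input_prim =
  in_arity :: nat
  outcomes :: "'v list \<Rightarrow> 'v set"

definition codom :: "'v input_prim \<Rightarrow> 'v set" where
  "codom p = (\<Union>va \<in> {va. length va = in_arity p}. outcomes p va)"

text \<open>
  The effect of an output primitive is external and leaves no trace in the program state, so that
  only its arity matters.
\<close>

record output_prim =
  out_arity :: nat

record ('l, 'g, 'v, 'm, 'o, 'id) language =
  wasm_step :: "('l, 'g, 'v, 'm, 'o, 'id) prog_state \<Rightarrow> ('l, 'g, 'v, 'm, 'o, 'id) prog_state \<Rightarrow> bool"
  in_prims :: "nat \<Rightarrow> 'v input_prim option"
  out_prims :: "nat \<Rightarrow> output_prim option"

definition wf_language :: "('l, 'g, 'v, 'm, 'o, 'id) language \<Rightarrow> bool" where
  "wf_language L \<longleftrightarrow>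
     right_unique (wasm_step L) \<and>
     (\<forall>j p va. in_prims L j = Some p \<longrightarrow> length va = in_arity p \<longrightarrow> codom p = outcomes p va)"

definition prim :: "('l, 'g, 'v, 'm, 'o, 'id) language \<Rightarrow> ('l, 'g, 'v, 'm, 'o, 'id) prog_state \<Rightarrow> bool" where
  "prim L K \<longleftrightarrow>
     (\<exists>i j es. instrs K = Call i j # es \<and> (in_prims L j \<noteq> None \<or> out_prims L j \<noteq> None))"

text \<open>
  \<open>return_call n r K K'\<close>: the next instruction of \<open>K\<close> is a call, and \<open>K'\<close> is \<open>K\<close> with this call
  removed and its \<open>n\<close> arguments on top of the stack replaced by the results \<open>r\<close>.
\<close>

definition return_call ::
  "nat \<Rightarrow> 'v list \<Rightarrow> ('l, 'g, 'v, 'm, 'o, 'id) prog_state \<Rightarrow> ('l, 'g, 'v, 'm, 'o, 'id) prog_state \<Rightarrow> bool" where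
  "return_call n r K K' \<longleftrightarrow>
     (\<exists>i j es va vs. instrs K = Call i j # es \<and> stack K = va @ vs \<and> length va = n \<and>
        K' = K\<lparr>stack := r @ vs, instrs := es\<rparr>)"

text \<open>The label \<open>v\<close> is the value returned by the primitive.\<close>

inductive input_prim_step ::
  "('l, 'g, 'v, 'm, 'o, 'id) language \<Rightarrow> 'v \<Rightarrow>
   ('l, 'g, 'v, 'm, 'o, 'id) prog_state \<Rightarrow> ('l, 'g, 'v, 'm, 'o, 'id) prog_state \<Rightarrow> bool"
  for L where
  "\<lbrakk>instrs K = Call i j # es; in_prims L j = Some p;
    v \<in> outcomes p (take (in_arity p) (stack K)); return_call (in_arity p) [v] K K'\<rbrakk>
   \<Longrightarrow> input_prim_step L v K K'"

inductive output_prim_step ::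
  "('l, 'g, 'v, 'm, 'o, 'id) language \<Rightarrow>
   ('l, 'g, 'v, 'm, 'o, 'id) prog_state \<Rightarrow> ('l, 'g, 'v, 'm, 'o, 'id) prog_state \<Rightarrow> bool"
  for L where
  "\<lbrakk>instrs K = Call i j # es; out_prims L j = Some p; return_call (out_arity p) [] K K'\<rbrakk>
   \<Longrightarrow> output_prim_step L K K'"

inductive lang_step ::
  "('l, 'g, 'v, 'm, 'o, 'id) language \<Rightarrow>
   ('l, 'g, 'v, 'm, 'o, 'id) prog_state \<Rightarrow> ('l, 'g, 'v, 'm, 'o, 'id) prog_state \<Rightarrow> bool"
  for L where
  Wasm: "\<lbrakk>\<not> prim L K; wasm_step L K K'\<rbrakk> \<Longrightarrow> lang_step L K K'"
| Input_Prim: "input_prim_step L v K K' \<Longrightarrow> lang_step L K K'"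
| Output_Prim: "output_prim_step L K K' \<Longrightarrow> lang_step L K K'"

datatype exec_state = Running | Paused

datatype ('v, 'id) server_msg =
  Step | Pause | Play | Break_Add 'id | Break_Rem 'id | Mock 'v | Inspect | Reset

datatype ('v, 'k) client_msg = Prim nat 'v | Executed nat | Snapshot 'k

text \<open>Execution state, inbox, outbox, breakpoints, instruction counter, program state.\<close>

datatype ('v, 'id, 'k) server =
  Server exec_state "('v, 'id) server_msg option" "('v, 'k) client_msg option" "'id set" nat
    (server_prog: 'k)

definition at_breakpoint :: "'id set \<Rightarrow> ('l, 'g, 'v, 'm, 'o, 'id) prog_state \<Rightarrow> bool" where
  "at_breakpoint bps K \<longleftrightarrow> (\<exists>e es. instrs K = e # es \<and> instr_id e \<in> bps)"

inductive server_step ::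
  "('l, 'g, 'v, 'm, 'o, 'id) language \<Rightarrow> ('l, 'g, 'v, 'm, 'o, 'id) prog_state \<Rightarrow>
   ('v, 'id, ('l, 'g, 'v, 'm, 'o, 'id) prog_state) server \<Rightarrow>
   ('v, 'id, ('l, 'g, 'v, 'm, 'o, 'id) prog_state) server \<Rightarrow> bool"
  for L K_start where
  Run:
    "\<lbrakk>\<not> prim L K; \<not> at_breakpoint bps K; lang_step L K K'\<rbrakk> \<Longrightarrow>
     server_step L K_start (Server Running None None bps c K) (Server Running None None bps (c + 1) K')"
| Run_Prim_Out:
    "\<lbrakk>output_prim_step L K K'; \<not> at_breakpoint bps K\<rbrakk> \<Longrightarrow>
     server_step L K_start (Server Running None None bps c K) (Server Running None None bps (c + 1) K')"
| Run_Prim_In: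
    "\<lbrakk>input_prim_step L v K K'; \<not> at_breakpoint bps K\<rbrakk> \<Longrightarrow>
     server_step L K_start (Server Running None None bps c K)
       (Server Running None (Some (Prim (c + 1) v)) bps 0 K')"
| Dbg_Break:
    "at_breakpoint bps K \<Longrightarrow>
     server_step L K_start (Server Running None None bps c K)
       (Server Paused None (Some (Executed c)) bps 0 K)"
| Dbg_Pause:
    "server_step L K_start (Server Running (Some Pause) None bps c K)
       (Server Paused None (Some (Executed c)) bps 0 K)"
| Dbg_Step:
    "\<lbrakk>\<not> prim L K; lang_step L K K'\<rbrakk> \<Longrightarrow>
     server_step L K_start (Server Paused (Some Step) None bps 0 K)
       (Server Paused None (Some (Executed 1)) bps 0 K')"
| Dbg_Step_Prim_Out:
    "output_prim_step L K K' \<Longrightarrow>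
     server_step L K_start (Server Paused (Some Step) None bps 0 K)
       (Server Paused None (Some (Executed 1)) bps 0 K')"
| Dbg_Step_Prim_In:
    "input_prim_step L v K K' \<Longrightarrow>
     server_step L K_start (Server Paused (Some Step) None bps 0 K)
       (Server Paused None (Some (Prim 1 v)) bps 0 K')"
| Dbg_Mock:
    "\<lbrakk>instrs K = Call i j # es; in_prims L j = Some p; v \<in> codom p;
      return_call (in_arity p) [v] K K'\<rbrakk> \<Longrightarrow>
     server_step L K_start (Server Paused (Some (Mock v)) None bps 0 K)
       (Server Paused None (Some (Prim 1 v)) bps 0 K')"
| Dbg_Bp_Add:
    "server_step L K_start (Server es (Some (Break_Add b)) None bps c K)
       (Server es None None (bps \<union> {b}) c K)"
| Dbg_Bp_Rem:
    "server_step L K_start (Server es (Some (Break_Rem b)) None bps c K)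
       (Server es None None (bps - {b}) c K)"
| Dbg_Play:
    "server_step L K_start (Server Paused (Some Play) None bps c K) (Server Running None None bps c K)"
| Dbg_Inspect:
    "server_step L K_start (Server Paused (Some Inspect) None bps c K)
       (Server Paused None (Some (Snapshot K)) bps c K)"
| Dbg_Reset:
    "server_step L K_start (Server Paused (Some Reset) None bps c K)
       (Server Paused None None bps 0 K_start)"

datatype 'v label = LStep | LMock 'v

datatype 'v mtree = Node (children: "('v label \<times> 'v mtree) list")

text \<open>
  Two different nodes of a tree may have equal subtrees. A node is therefore identified by its
  position, the list of child indices on the path from the root.
\<close>

type_synonym pos = "nat list"

primrec is_node :: "pos \<Rightarrow> 'v mtree \<Rightarrow> bool" where
  "is_node [] T = True"
| "is_node (i # p) T = (i < length (children T) \<and> is_node p (snd (children T ! i)))"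

primrec subtree_at :: "pos \<Rightarrow> 'v mtree \<Rightarrow> 'v mtree" where
  "subtree_at [] T = T"
| "subtree_at (i # p) T = subtree_at p (snd (children T ! i))"

primrec replace_at :: "pos \<Rightarrow> 'v mtree \<Rightarrow> 'v mtree \<Rightarrow> 'v mtree" where
  "replace_at [] S T = S"
| "replace_at (i # p) S T =
     (let (l, T') = children T ! i in Node ((children T)[i := (l, replace_at p S T')]))"

primrec labels_along :: "pos \<Rightarrow> 'v mtree \<Rightarrow> 'v label list" where
  "labels_along [] T = []"
| "labels_along (i # p) T = (let (l, T') = children T ! i in l # labels_along p T')"

definition follow :: "'v label \<Rightarrow> 'v mtree \<times> pos \<Rightarrow> 'v mtree \<times> pos" where
  "follow l = (\<lambda>(T, p).
     let ts = children (subtree_at p T) in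
     if l \<in> fst ` set ts
     then (T, p @ [LEAST i. i < length ts \<and> fst (ts ! i) = l])
     else (replace_at p (Node (ts @ [(l, Node [])])) T, p @ [length ts]))"

definition traverse :: "'v label list \<Rightarrow> 'v mtree \<times> pos \<Rightarrow> 'v mtree \<times> pos" where
  "traverse ls = fold follow ls"

datatype ('v, 'k) client_input = From_Server "('v, 'k) client_msg" | Slide pos

text \<open>Inbox, outbox (head first), tree root, current node.\<close>

datatype ('v, 'id, 'k) client =
  Client "('v, 'k) client_input option" "('v, 'id) server_msg list" "'v mtree" pos

primrec label_msg :: "'v label \<Rightarrow> ('v, 'id) server_msg" where
  "label_msg LStep = Step"
| "label_msg (LMock v) = Mock v"

inductive client_step ::
  "('k \<Rightarrow> 'v mtree) \<Rightarrow> ('v, 'id, 'k) client \<Rightarrow> ('v, 'id, 'k) client \<Rightarrow> bool"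
  for concolic where
  Executed:
    "traverse (replicate c LStep) (T, cur) = (T', cur') \<Longrightarrow>
     client_step concolic (Client (Some (From_Server (Executed c))) q T cur) (Client None q T' cur')"
| Prim:
    "\<lbrakk>c \<ge> 1; traverse (replicate (c - 1) LStep @ [LMock v]) (T, cur) = (T', cur')\<rbrakk> \<Longrightarrow>
     client_step concolic (Client (Some (From_Server (Prim c v))) q T cur) (Client None q T' cur')"
| Slide:
    "target = cur @ p \<Longrightarrow>
     client_step concolic (Client (Some (Slide target)) [] T cur)
       (Client None (map label_msg (labels_along p (subtree_at cur T))) T cur)"
| Slide_Restart:
    "\<nexists>p. target = cur @ p \<Longrightarrow>
     client_step concolic (Client (Some (Slide target)) [] T cur)
       (Client None (Reset # map label_msg (labels_along target T)) T [])"
| Concolic_Receive: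
    "client_step concolic (Client (Some (From_Server (Snapshot K))) q T cur)
       (Client None q (replace_at cur (concolic K) T) cur)"

definition accepts :: "exec_state \<Rightarrow> ('v, 'id) server_msg \<Rightarrow> bool" where
  "accepts es m \<longleftrightarrow> (case es of Running \<Rightarrow> m = Pause | Paused \<Rightarrow> m \<noteq> Pause)"

type_synonym ('v, 'id, 'k) dbg = "('v, 'id, 'k) client \<times> ('v, 'id, 'k) server"

inductive dbg_step ::
  "('l, 'g, 'v, 'm, 'o, 'id) language \<Rightarrow> ('l, 'g, 'v, 'm, 'o, 'id) prog_state \<Rightarrow>
   (('l, 'g, 'v, 'm, 'o, 'id) prog_state \<Rightarrow> 'v mtree) \<Rightarrow>
   ('v, 'id, ('l, 'g, 'v, 'm, 'o, 'id) prog_state) dbg \<Rightarrow>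
   ('v, 'id, ('l, 'g, 'v, 'm, 'o, 'id) prog_state) dbg \<Rightarrow> bool"
  for L K_start concolic where
  Server_To_Client:
    "client_step concolic (Client (Some (From_Server m)) q T cur) C' \<Longrightarrow>
     dbg_step L K_start concolic
       (Client None q T cur, Server es None (Some m) bps c K)
       (C', Server es None None bps c K)"
| Client_To_Server:
    "\<lbrakk>accepts es m; server_step L K_start (Server es (Some m) None bps c K) S'\<rbrakk> \<Longrightarrow>
     dbg_step L K_start concolic
       (Client None (m # q) T cur, Server es None None bps c K)
       (Client None q T cur, S')"
| Server_Step:
    "server_step L K_start (Server es None None bps c K) S' \<Longrightarrow>
     dbg_step L K_start concolic
       (Client None [] T cur, Server es None None bps c K)
       (Client None [] T cur, S')"
| User_Msg:
    "dbg_step L K_start concolic (Client mi q T cur, S) (Client mi (q @ [m]) T cur, S)"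
| User_Slide:
    "\<lbrakk>is_node target T; client_step concolic (Client (Some (Slide target)) [] T cur) C'\<rbrakk> \<Longrightarrow>
     dbg_step L K_start concolic
       (Client None [] T cur, Server es None None bps c K)
       (C', Server es None None bps c K)"

definition dbg_start :: "'k \<Rightarrow> ('v, 'id, 'k) dbg" where
  "dbg_start K_start = (Client None [] (Node []) [], Server Paused None None {} 0 K_start)"

definition prog_of :: "('v, 'id, 'k) dbg \<Rightarrow> 'k" where
  "prog_of D = server_prog (snd D)"

end

theory Submission
  imports Defs
begin

text \<open>
  A paused debugger with empty queues mimics every step of the language in one round: the user
  issues \<^emph>\<open>step\<close>, the server executes the next instruction, and the client consumes the reply, after
  which the debugger is paused with empty queues again. No mocking is needed, since stepping over
  an input primitive may already return any of its outcomes.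
\<close>

text \<open>The counter is 0 because the server accepts \<open>Step\<close> only then. Tree and
  current node stay parameters since every reply may change them.\<close>

definition idle :: "'v mtree \<Rightarrow> pos \<Rightarrow> 'k \<Rightarrow> ('v, 'id, 'k) dbg" where
  "idle T cur K = (Client None [] T cur, Server Paused None None {} 0 K)"

text \<open>Each rule of \<open>lang_step\<close> has its own stepping rule on the paused server.
  The shape of \<open>msg\<close> is recorded so that the client is sure to be able to consume
  it.\<close>

lemma server_step_Step:
  assumes "lang_step L K K'"
  obtains msg where
    "server_step L K_start (Server Paused (Some Step) None bps 0 K)
       (Server Paused None (Some msg) bps 0 K')"
    and "msg = Executed 1 \<or> (\<exists>v. msg = Prim 1 v)"
  using assms
proof cases
  case Wasm
  \<comment> \<open>\<open>Dbg_Step\<close> asks for \<open>lang_step\<close> rather than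
    \<open>wasm_step\<close>, hence \<open>assms\<close>.\<close>
  with assms show ?thesis using that by (blast intro: Dbg_Step)
next
  case (Input_Prim v)
  then show ?thesis using that by (blast intro: Dbg_Step_Prim_In)
next
  case Output_Prim
  then show ?thesis using that by (blast intro: Dbg_Step_Prim_Out)
qed

text \<open>\<open>traverse\<close> is total, so a client rule always applies; for
  \<open>Prim\<close> the count 1 meets the side condition \<open>c \<ge> 1\<close>.\<close>

lemma client_step_reply:
  assumes "msg = Executed 1 \<or> (\<exists>v. msg = Prim 1 v)"
  obtains T' cur' where
    "client_step concolic (Client (Some (From_Server msg)) q T cur) (Client None q T' cur')"
  using assms by (metis client_step.Executed client_step.Prim order_refl surj_pair)

lemma idle_simulates_lang_step:
  fixes L :: "('l, 'g, 'v, 'm, 'o, 'id) language"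
  assumes "lang_step L K K'"
  obtains T' cur' where "(dbg_step L K_start concolic)\<^sup>*\<^sup>* (idle T cur K) (idle T' cur' K')"
proof -
  obtain msg where
    server: "server_step L K_start (Server Paused (Some Step) None {} 0 K)
       (Server Paused None (Some msg) {} 0 K')"
    and msg: "msg = Executed 1 \<or> (\<exists>v. msg = Prim 1 v)"
    using server_step_Step[OF assms] by blast
  obtain T' cur' where
    client: "client_step concolic (Client (Some (From_Server msg)) [] T cur)
       (Client None ([] :: ('v, 'id) server_msg list) T' cur')"
    using client_step_reply[OF msg] by blast
  let ?R = "dbg_step L K_start concolic"
  let ?S = "Server Paused None None {} 0 K"
  have "?R (idle T cur K) (Client None [Step] T cur, ?S)"
    unfolding idle_def using User_Msg[where q = "[]"] by simp
  moreover have "?R (Client None [Step] T cur, ?S)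
      (Client None [] T cur, Server Paused None (Some msg) {} 0 K')"
    using server by (intro Client_To_Server) (simp_all add: accepts_def)
  moreover have "?R (Client None [] T cur, Server Paused None (Some msg) {} 0 K') (idle T' cur' K')"
    unfolding idle_def using client by (rule Server_To_Client)
  ultimately have "?R\<^sup>*\<^sup>* (idle T cur K) (idle T' cur' K')"
    by (meson converse_rtranclp_into_rtranclp rtranclp.rtrancl_refl)
  then show ?thesis by (rule that)
qed

text \<open>Rounds can be chained because each one ends in an idle state and the next may start from
  any tree and current node.\<close>

lemma idle_simulates_lang_steps:
  assumes "(lang_step L)\<^sup>*\<^sup>* K K'"
  shows "\<exists>T' cur'. (dbg_step L K_start concolic)\<^sup>*\<^sup>* (idle T cur K) (idle T' cur' K')"
  using assms
proof induction
  case base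
  then show ?case by blast
next
  case (step K' K'')
  then show ?case by (meson idle_simulates_lang_step rtranclp_trans)
qed

theorem theorem2:
  fixes L :: "('l, 'g, 'v, 'm, 'o, 'id) language"
    and K_start K' :: "('l, 'g, 'v, 'm, 'o, 'id) prog_state"
    and concolic :: "('l, 'g, 'v, 'm, 'o, 'id) prog_state \<Rightarrow> 'v mtree"
  assumes "wf_language L"
    and "(lang_step L)\<^sup>*\<^sup>* K_start K'"
  shows "\<exists>dbg'. (dbg_step L K_start concolic)\<^sup>*\<^sup>* (dbg_start K_start) dbg' \<and> prog_of dbg' = K'"
proof -
  obtain T cur where
    "(dbg_step L K_start concolic)\<^sup>*\<^sup>* (idle (Node []) [] K_start) (idle T cur K')"
    using idle_simulates_lang_steps[OF assms(2)] by blast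
  moreover have "dbg_start K_start = idle (Node []) [] K_start"
    by (simp add: dbg_start_def idle_def)
  moreover have "prog_of (idle T cur K') = K'"
    by (simp add: prog_of_def idle_def)
  ultimately show ?thesis by metis
qed

end
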